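(* Let $s\geq 2$ and $n\geq 3s-2$ be integers, and let $G$ be a graph of order $n$ with complement $\overline{G}$. Then \[ \sum_{i=2}^{s}\left(\mu_i^2(G)+\mu_i^2(\overline{G})\right)<\frac{n^2}{4}. \]
   Context: Graphs are finite and simple. For a graph $G$ of order $n$, $\mu_1(G)\geq\mu_2(G)\geq\cdots\geq\mu_n(G)$ denote the eigenvalues of its adjacency matrix, and $\overline{G}$ denotes the complement of $G$. *)

theory Defs
  imports "Graph_Theory.Pair_Digraph" "Jordan_Normal_Form.Char_Poly"
begin

text \<open>Finite simple graphs are modelled by the locale \<^locale>\<open>pair_graph\<close>: every edge
  is present as two opposite arcs.\<close>

definition graph_complement :: "'a pair_pre_digraph \<Rightarrow> 'a pair_pre_digraph" where
  "graph_complement G = \<lparr> pverts = pverts G,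
     parcs = {(u, v). u \<in> pverts G \<and> v \<in> pverts G \<and> u \<noteq> v \<and> (u, v) \<notin> parcs G} \<rparr>"

text \<open>Matrices are indexed by natural numbers, so the vertices have to be listed in some order.
  The characteristic polynomial of the adjacency matrix does not depend on the order.\<close>

definition vertex_list :: "'a pair_pre_digraph \<Rightarrow> 'a list" where
  "vertex_list G = (SOME vs. distinct vs \<and> set vs = pverts G)"

definition adjacency_matrix :: "'a pair_pre_digraph \<Rightarrow> real mat" where
  "adjacency_matrix G = (let vs = vertex_list G; n = length vs in
     mat n n (\<lambda>(i, j). if (vs ! i, vs ! j) \<in> parcs G then 1 else 0))"

text \<open>Eigenvalues with multiplicity, in nonincreasing order. The adjacency matrix of a graph is real
  symmetric, so all its eigenvalues are real and algebraic and geometric multiplicities agree;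
  for a graph with \<open>n\<close> vertices the list has length \<open>n\<close>.\<close>

definition eigenvalue_list :: "'a pair_pre_digraph \<Rightarrow> real list" where
  "eigenvalue_list G = rev (sorted_list_of_multiset (proots (char_poly (adjacency_matrix G))))"

text \<open>The \<open>i\<close>-th largest eigenvalue, counted from 1.\<close>

definition graph_eigenvalue :: "nat \<Rightarrow> 'a pair_pre_digraph \<Rightarrow> real" (\<open>\<mu>\<close>) where
  "\<mu> i G = eigenvalue_list G ! (i - 1)"

lemma pair_graph_complement:
  assumes "pair_graph G"
  shows "pair_graph (graph_complement G)"
proof -
  interpret pair_graph G by fact
  have "finite {(u, v). u \<in> pverts G \<and> v \<in> pverts G \<and> u \<noteq> v \<and> (u, v) \<notin> parcs G}"
    by (rule finite_subset[of _ "pverts G \<times> pverts G"]) (auto simp: pair_finite_verts)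
  moreover have "(u, v) \<in> parcs G \<longleftrightarrow> (v, u) \<in> parcs G" for u v
    using pair_sym_arcs by (auto simp: symmetric_def dest: symD)
  ultimately show ?thesis
    by unfold_locales
      (auto simp: graph_complement_def symmetric_def pair_finite_verts intro!: symI)
qed

lemma vertex_list:
  assumes "pair_graph G"
  shows "distinct (vertex_list G)" "set (vertex_list G) = pverts G"
proof -
  interpret pair_graph G by fact
  have "\<exists>vs. distinct vs \<and> set vs = pverts G"
    using finite_distinct_list[OF pair_finite_verts] by blast
  from someI_ex[OF this] show "distinct (vertex_list G)" "set (vertex_list G) = pverts G"
    by (auto simp: vertex_list_def)
qed

end

theory Submission
  imports Defs
begin

text \<open>Number the eigenvalues of \<open>G\<close> and its complement from 0 as \<open>a\<close> and \<open>b\<close>. The adjacency matrices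
  add up to \<open>J - I\<close>, so Weyl's inequality gives \<open>a k + b (n - k) \<le> -1\<close> for \<open>1 \<le> k < n\<close>. Let \<open>1 \<le> k < s\<close>.
  If \<open>a k \<ge> 0\<close>, then \<open>(a k)\<^sup>2 \<le> (b (n - k))\<^sup>2\<close>; otherwise \<open>(a k)\<^sup>2 \<le> (a (k + s - 1))\<^sup>2\<close> by monotonicity.
  The index ranges \<open>{1..<s}\<close>, \<open>{s..<2 * s - 1}\<close> and \<open>{n - s + 1..<n}\<close> are disjoint because
  \<open>n \<ge> 3 * s - 2\<close>, so the sum in question is at most half of the sum of all squares except
  \<open>(a 0)\<^sup>2 + (b 0)\<^sup>2\<close>. All squares sum to \<open>n * (n - 1)\<close>, and \<open>a 0 + b 0 \<ge> n - 1\<close> makes the excluded two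
  at least \<open>(n - 1)\<^sup>2 / 2\<close>, which leaves \<open>(n\<^sup>2 - 1) / 4\<close>.\<close>

section \<open>Spectral theorem for real symmetric matrices\<close>

lemma symmetric_scalar_prod:
  fixes A :: "'a :: comm_semiring_0 mat"
  assumes "A \<in> carrier_mat n n" "transpose_mat A = A" "x \<in> carrier_vec n" "y \<in> carrier_vec n"
  shows "(A *\<^sub>v x) \<bullet> y = x \<bullet> (A *\<^sub>v y)"
  using transpose_vec_mult_scalar[OF assms(1,4,3)] assms
  by (metis comm_scalar_prod mult_mat_vec_carrier)

text \<open>Since \<open>A\<close> has real entries, conjugating an eigenvector \<open>v\<close> for
  \<open>z\<close> gives one for the conjugate of \<open>z\<close>. Moving \<open>A\<close> across
  the product of \<open>v\<close> with its conjugate equates the two eigenvalues, as that product is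
  nonzero.\<close>

lemma real_symmetric_eigenvalue_real:
  fixes A :: "real mat"
  assumes A: "A \<in> carrier_mat n n" and sym: "transpose_mat A = A"
    and ev: "eigenvalue (map_mat complex_of_real A) z"
  shows "z \<in> \<real>"
proof -
  let ?B = "map_mat complex_of_real A"
  have B: "?B \<in> carrier_mat n n" and symB: "transpose_mat ?B = ?B"
    using A sym by (auto simp: map_mat_transpose)
  from ev obtain v where v: "v \<in> carrier_vec n" "v \<noteq> 0\<^sub>v n" and eq: "?B *\<^sub>v v = z \<cdot>\<^sub>v v"
    using B unfolding eigenvalue_def eigenvector_def by auto
  have "conjugate (?B *\<^sub>v v) = ?B *\<^sub>v conjugate v"
    using A v by (intro eq_vecI) (auto simp: scalar_prod_def sum_conjugate)
  then have eq': "?B *\<^sub>v conjugate v = conjugate z \<cdot>\<^sub>v conjugate v"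
    using eq by (simp add: conjugate_smult_vec)
  have "z * (v \<bullet>c v) = (?B *\<^sub>v v) \<bullet>c v"
    using v by (simp add: eq)
  also have "\<dots> = conjugate z * (v \<bullet>c v)"
    using symmetric_scalar_prod[OF B symB v(1), of "conjugate v"] v by (simp add: eq')
  finally have "z = cnj z"
    using v by simp
  then show ?thesis
    by (simp add: complex_is_Real_iff complex_eq_iff)
qed

text \<open>The characteristic polynomial splits over the complex numbers with real roots only. The
  factorization descends to the reals because the embedding of polynomials is injective.\<close>

lemma real_symmetric_char_poly_splits:
  fixes A :: "real mat"
  assumes A: "A \<in> carrier_mat n n" and sym: "transpose_mat A = A"
  shows "\<exists>es. char_poly A = (\<Prod>a\<leftarrow>es. [:- a, 1:]) \<and> length es = n"
proof -
  interpret h: map_poly_inj_idom_hom complex_of_real ..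
  let ?B = "map_mat complex_of_real A"
  have B: "?B \<in> carrier_mat n n" using A by auto
  from char_poly_factorized[OF B] obtain as where
    as: "char_poly ?B = (\<Prod>a\<leftarrow>as. [:- a, 1:])" "length as = n" by blast
  have "z \<in> \<real>" if "z \<in> set as" for z
  proof (rule real_symmetric_eigenvalue_real[OF A sym])
    show "eigenvalue ?B z"
      unfolding eigenvalue_root_char_poly[OF B] as(1) using that
      by (induction as) auto
  qed
  then have "map complex_of_real (map Re as) = as"
    by (auto intro!: map_idI)
  moreover have "map_poly complex_of_real (\<Prod>a\<leftarrow>rs. [:- a, 1:]) =
      (\<Prod>a\<leftarrow>map complex_of_real rs. [:- a, 1:])" for rs
    by (simp add: h.hom_prod_list o_def of_real_hom.map_poly_pCons_hom del: h.prod_list_map_hom)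
  ultimately have "map_poly complex_of_real (char_poly A) =
      map_poly of_real (\<Prod>a\<leftarrow>map Re as. [:- a, 1:])"
    using as(1) of_real_hom.char_poly_hom[OF A] by metis
  then have "char_poly A = (\<Prod>a\<leftarrow>map Re as. [:- a, 1:])"
    by simp
  then show ?thesis using as(2) by (metis length_map)
qed

text \<open>The reflection in the hyperplane orthogonal to \<open>v - unit_vec n 0\<close> exchanges
  these two unit vectors.\<close>

lemma householder:
  fixes v :: "real vec"
  assumes v: "v \<in> carrier_vec n" "v \<bullet> v = 1" and n: "0 < n"
  obtains H where "H \<in> carrier_mat n n" "transpose_mat H = H" "H * H = 1\<^sub>m n"
    "H *\<^sub>v v = unit_vec n 0"
proof -
  define w where "w = v - unit_vec n 0"
  define c where "c = 2 / (w \<bullet> w)"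
  define H where "H = mat n n (\<lambda>(i, j). (if i = j then 1 else 0) - c * w $ i * w $ j)"
  have w: "w \<in> carrier_vec n" using v by (simp add: w_def)
  have ww: "(\<Sum>k = 0..<n. w $ k * w $ k) = w \<bullet> w"
    using w by (simp add: scalar_prod_def)
  \<comment> \<open>This includes \<open>w = 0\<close>: division by zero yields 0, so
    \<open>c = 0\<close> and \<open>H\<close> is the identity.\<close>
  have cc: "c * c * (w \<bullet> w) = 2 * c"
    by (simp add: c_def)
  have "(H * H) $$ (i, j) = (1\<^sub>m n :: real mat) $$ (i, j)" if ij: "i < n" "j < n" for i j
  proof -
    have "(H * H) $$ (i, j) = (\<Sum>k = 0..<n. ((if i = k then 1 else 0) - c * w $ i * w $ k) *
        ((if k = j then 1 else 0) - c * w $ k * w $ j))"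
      using ij by (simp add: H_def scalar_prod_def)
    also have "\<dots> = (\<Sum>k = 0..<n. (if i = k then if k = j then 1 else 0 else 0)
        - (if i = k then c * w $ k * w $ j else 0) - (if k = j then c * w $ i * w $ k else 0)
        + c * c * w $ i * w $ j * (w $ k * w $ k))"
      by (intro sum.cong) (auto simp: algebra_simps)
    also have "\<dots> = (if i = j then 1 else 0) - 2 * c * w $ i * w $ j
        + c * c * w $ i * w $ j * (w \<bullet> w)"
      using ij by (simp add: sum.distrib sum_subtractf sum_distrib_left[symmetric] ww)
    also have "\<dots> = (if i = j then 1 else 0) - 2 * c * w $ i * w $ j
        + (c * c * (w \<bullet> w)) * w $ i * w $ j"
      by simp
    also have "\<dots> = (1\<^sub>m n :: real mat) $$ (i, j)"
      using ij unfolding cc by simp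
    finally show ?thesis .
  qed
  then have HH: "H * H = 1\<^sub>m n"
    by (intro eq_matI) (auto simp: H_def)
  have uv: "unit_vec n 0 \<bullet> v = v $ 0" "v \<bullet> unit_vec n 0 = v $ 0"
    using v n by auto
  have wv: "w \<bullet> v = 1 - v $ 0"
    using v n by (simp add: w_def minus_scalar_prod_distrib[of _ n])
  \<comment> \<open>As \<open>v\<close> and the basis vector both have length 1,
    \<open>w \<bullet> unit_vec n 0 = - (w \<bullet> v)\<close>. Hence
    \<open>c * (w \<bullet> v) = 1\<close> for nonzero \<open>w\<close>, and \<open>H\<close>
    subtracts exactly \<open>w\<close> from \<open>v\<close>.\<close>
  have "w \<bullet> w = w \<bullet> v - w \<bullet> unit_vec n 0"
    using w v n by (subst (2) w_def) (simp add: scalar_prod_minus_distrib[of _ n])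
  also have "\<dots> = 2 * (w \<bullet> v)"
    using v n w by (simp add: wv) (simp add: w_def)
  finally have wwv: "w \<bullet> w = 2 * (w \<bullet> v)" .
  have Hv: "H *\<^sub>v v = unit_vec n 0"
  proof (intro eq_vecI)
    fix i assume "i < dim_vec (unit_vec n 0 :: real vec)"
    then have i: "i < n" by simp
    have "(H *\<^sub>v v) $ i = (\<Sum>k = 0..<n. ((if i = k then 1 else 0) - c * w $ i * w $ k) * v $ k)"
      using i v by (simp add: H_def scalar_prod_def)
    also have "\<dots> = (\<Sum>k = 0..<n. (if i = k then v $ k else 0) - c * w $ i * (w $ k * v $ k))"
      by (intro sum.cong) (auto simp: algebra_simps)
    also have "\<dots> = v $ i - c * w $ i * (w \<bullet> v)"
      using i v by (simp add: sum_subtractf sum_distrib_left[symmetric] scalar_prod_def)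
    also have "\<dots> = v $ i - w $ i"
    proof (cases "w \<bullet> w = 0")
      case True
      then have "w = 0\<^sub>v n"
        using conjugate_square_eq_0_vec[OF w] by simp
      then show ?thesis using i by simp
    next
      case False
      then show ?thesis by (simp add: c_def wwv)
    qed
    also have "\<dots> = (unit_vec n 0 :: real vec) $ i"
      using i v by (simp add: w_def)
    finally show "(H *\<^sub>v v) $ i = (unit_vec n 0 :: real vec) $ i" .
  qed (simp add: H_def)
  show ?thesis
    using HH Hv by (intro that[of H]) (auto simp: H_def intro!: eq_matI)
qed

text \<open>Deflation, by induction on the list of roots: a reflection moves a unit eigenvector for
  \<open>e\<close> to the first basis vector, which splits off a 1 by 1 block and leaves a smaller
  symmetric matrix. The diagonal keeps the order of \<open>es\<close>, so any order of the roots can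
  be prescribed.\<close>

lemma real_symmetric_diagonalization:
  fixes A :: "real mat"
  assumes "A \<in> carrier_mat n n" "transpose_mat A = A"
    "char_poly A = (\<Prod>a\<leftarrow>es. [:- a, 1:])"
  shows "\<exists>P \<in> carrier_mat n n. transpose_mat P * P = 1\<^sub>m n \<and>
    transpose_mat P * A * P = mat_diag n ((!) es)"
  using assms
proof (induction es arbitrary: n A)
  case Nil
  then have "n = 0"
    using degree_monic_char_poly[of A n] by simp
  with Nil.prems(1) show ?case
    by (intro bexI[of _ "1\<^sub>m 0"]) (auto simp: mat_diag_def)
next
  case (Cons e es)
  note A = Cons.prems(1) and sym = Cons.prems(2)
  have "eigenvalue A e"
    unfolding eigenvalue_root_char_poly[OF A] Cons.prems(3) by simp
  then obtain u where u: "u \<in> carrier_vec n" "u \<noteq> 0\<^sub>v n" and Au: "A *\<^sub>v u = e \<cdot>\<^sub>v u"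
    using A unfolding eigenvalue_def eigenvector_def by auto
  have "degree (char_poly A) = length (e # es)"
    unfolding Cons.prems(3) by (rule degree_linear_factors)
  then obtain m where n: "n = Suc m" and m: "length es = m"
    using degree_monic_char_poly[OF A] by auto
  define v where "v = (1 / sqrt (u \<bullet> u)) \<cdot>\<^sub>v u"
  have uu: "u \<bullet> u > 0"
    using conjugate_square_greater_0_vec[OF u(1)] u(2) by simp
  have v: "v \<in> carrier_vec n" "v \<bullet> v = 1"
    using u uu by (simp_all add: v_def)
  have Av: "A *\<^sub>v v = e \<cdot>\<^sub>v v"
    using u A Au by (simp add: v_def mult_mat_vec smult_smult_assoc mult.commute)
  obtain H where H: "H \<in> carrier_mat n n" "transpose_mat H = H" "H * H = 1\<^sub>m n"
    and Hv: "H *\<^sub>v v = unit_vec n 0"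
    using householder[OF v] n by auto
  have "H *\<^sub>v unit_vec n 0 = H *\<^sub>v (H *\<^sub>v v)"
    by (simp add: Hv)
  also have "\<dots> = v"
    using H v by (simp flip: assoc_mult_mat_vec[of _ n n _ n])
  finally have He: "H *\<^sub>v unit_vec n 0 = v" .
  define C where "C = H * A * H"
  have C: "C \<in> carrier_mat n n" using H A by (simp add: C_def)
  have symC: "transpose_mat C = C"
    using H A sym by (simp add: C_def transpose_mult[of _ n n _ n])
  have "C *\<^sub>v unit_vec n 0 = H *\<^sub>v (A *\<^sub>v v)"
    using H A v by (simp add: C_def assoc_mult_mat_vec[of _ n n _ n] He)
  also have "\<dots> = e \<cdot>\<^sub>v unit_vec n 0"
    using H v by (simp add: Av mult_mat_vec Hv)
  finally have Ce: "C *\<^sub>v unit_vec n 0 = e \<cdot>\<^sub>v unit_vec n 0" .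
  \<comment> \<open>The eigenvector equation determines the first column of \<open>C\<close>;
    symmetry then determines the first row.\<close>
  have C0: "C $$ (i, 0) = (if i = 0 then e else 0)" if "i < n" for i
  proof -
    have "C $$ (i, 0) = (C *\<^sub>v unit_vec n 0) $ i"
      using that C n by simp
    also have "\<dots> = (if i = 0 then e else 0)"
      unfolding Ce using that n by simp
    finally show ?thesis .
  qed
  have C0': "C $$ (0, i) = (if i = 0 then e else 0)" if "i < n" for i
    using C0[OF that] symC C that n by (metis carrier_matD index_transpose_mat(1) zero_less_Suc)
  define E where "E = mat 1 1 (\<lambda>_. e)"
  define A' where "A' = mat m m (\<lambda>(i, j). C $$ (Suc i, Suc j))"
  have blocks: "C = four_block_mat E (0\<^sub>m 1 m) (0\<^sub>m m 1) A'"
  proof (rule eq_matI)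
    fix i j
    assume "i < dim_row (four_block_mat E (0\<^sub>m 1 m) (0\<^sub>m m 1) A')"
      "j < dim_col (four_block_mat E (0\<^sub>m 1 m) (0\<^sub>m m 1) A')"
    then have "i < Suc m" "j < Suc m" by (simp_all add: E_def A'_def)
    then show "C $$ (i, j) = four_block_mat E (0\<^sub>m 1 m) (0\<^sub>m m 1) A' $$ (i, j)"
      using C0[of i] C0'[of j] n by (auto simp: E_def A'_def)
  qed (use C n in \<open>auto simp: E_def A'_def\<close>)
  have E: "E \<in> carrier_mat 1 1" and A': "A' \<in> carrier_mat m m"
    by (simp_all add: E_def A'_def)
  have symA': "transpose_mat A' = A'"
  proof (rule eq_matI)
    fix i j assume "i < dim_row A'" "j < dim_col A'"
    then have "Suc i < n" "Suc j < n" by (simp_all add: A'_def n)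
    then have "C $$ (Suc j, Suc i) = C $$ (Suc i, Suc j)"
      using symC C by (metis carrier_matD index_transpose_mat(1))
    then show "transpose_mat A' $$ (i, j) = A' $$ (i, j)"
      using \<open>Suc i < n\<close> \<open>Suc j < n\<close> by (simp add: A'_def n)
  qed (simp_all add: A'_def)
  have "similar_mat A C"
  proof (unfold similar_mat_def, intro exI, rule similar_mat_witI)
    have "H * C * H = (H * H) * A * (H * H)"
      using H(1) A by (simp add: C_def assoc_mult_mat[of _ n n _ n _ n])
    then show "A = H * C * H" using H A by simp
  qed (use H A C in auto)
  \<comment> \<open>Similarity preserves the characteristic polynomial, and the block form factors
    it, so the linear factor of \<open>e\<close> can be cancelled.\<close>
  then have "[:- e, 1:] * char_poly A' = (\<Prod>a\<leftarrow>e # es. [:- a, 1:])"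
    using char_poly_similar[of A C] Cons.prems(3)
      char_poly_four_block_zeros_col[OF E _ A', of "0\<^sub>m 1 m"]
    by (simp add: blocks E_def char_poly_defs det_single)
  then have "char_poly A' = (\<Prod>a\<leftarrow>es. [:- a, 1:])"
    by (simp del: mult_pCons_left)
  from Cons.IH[OF A' symA' this] obtain P where P: "P \<in> carrier_mat m m"
    "transpose_mat P * P = 1\<^sub>m m" "transpose_mat P * A' * P = mat_diag m ((!) es)" by blast
  define Q where "Q = four_block_mat (1\<^sub>m 1) (0\<^sub>m 1 m) (0\<^sub>m m 1) P"
  have Q: "Q \<in> carrier_mat n n"
    using P(1) four_block_carrier_mat[of "1\<^sub>m 1" 1 1 P m m] by (simp add: Q_def n)
  have Qt: "transpose_mat Q = four_block_mat (1\<^sub>m 1) (0\<^sub>m 1 m) (0\<^sub>m m 1) (transpose_mat P)"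
    using P(1) by (simp add: Q_def transpose_four_block_mat[of _ 1 1 _ m _ m])
  have block_mult: "four_block_mat X (0\<^sub>m 1 m) (0\<^sub>m m 1) Y * four_block_mat X' (0\<^sub>m 1 m) (0\<^sub>m m 1) Y'
      = four_block_mat (X * X') (0\<^sub>m 1 m) (0\<^sub>m m 1) (Y * Y')"
    if "X \<in> carrier_mat 1 1" "X' \<in> carrier_mat 1 1" "Y \<in> carrier_mat m m" "Y' \<in> carrier_mat m m"
    for X X' Y Y' :: "real mat"
    using that by (subst mult_four_block_mat[of _ 1 1 _ m _ m _ _ 1 _ m]) auto
  have QQ: "transpose_mat Q * Q = 1\<^sub>m n"
    unfolding Qt unfolding Q_def using P(1) four_block_one_mat[of 1 m]
    by (subst block_mult) (auto simp: P(2) n)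
  have "transpose_mat Q * C * Q = four_block_mat E (0\<^sub>m 1 m) (0\<^sub>m m 1) (mat_diag m ((!) es))"
    unfolding Qt unfolding Q_def blocks using P(1) E A'
    by (simp only: block_mult one_carrier_mat transpose_carrier_mat mult_carrier_mat[of _ m m]
      left_mult_one_mat[of _ 1 1] right_mult_one_mat[of _ 1 1] P(3))
  also have "\<dots> = mat_diag n ((!) (e # es))"
    by (rule eq_matI) (auto simp: E_def mat_diag_def n nth_Cons')
  finally have QCQ: "transpose_mat Q * C * Q = mat_diag n ((!) (e # es))" .
  have "transpose_mat (H * Q) * (H * Q) = transpose_mat Q * (H * H) * Q"
    using H(1,2) Q by (simp add: transpose_mult[of _ n n _ n] assoc_mult_mat[of _ n n _ n _ n])
  moreover have "transpose_mat (H * Q) * A * (H * Q) = transpose_mat Q * C * Q"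
    using H(1,2) Q A by (simp add: transpose_mult[of _ n n _ n] assoc_mult_mat[of _ n n _ n _ n] C_def)
  ultimately show ?case
    using H Q QQ QCQ by (intro bexI[of _ "H * Q"]) auto
qed

section \<open>Orthonormal eigenbases and quadratic forms\<close>

text \<open>Orthonormality and completeness enter through Parseval's identity, the form in which
  vectors are expanded below. Indices start at 0, so \<open>ev 0\<close> is the largest
  eigenvalue.\<close>

locale eigenbasis =
  fixes n :: nat and A :: "real mat" and ev :: "nat \<Rightarrow> real" and v :: "nat \<Rightarrow> real vec"
  assumes A: "A \<in> carrier_mat n n"
    and v: "\<And>i. i < n \<Longrightarrow> v i \<in> carrier_vec n"
    and v_unit: "\<And>i. i < n \<Longrightarrow> v i \<bullet> v i = 1"
    and sym: "transpose_mat A = A"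
    and eigen: "\<And>i. i < n \<Longrightarrow> A *\<^sub>v v i = ev i \<cdot>\<^sub>v v i"
    and parseval: "\<And>x y. \<lbrakk>x \<in> carrier_vec n; y \<in> carrier_vec n\<rbrakk> \<Longrightarrow>
      x \<bullet> y = (\<Sum>i<n. (v i \<bullet> x) * (v i \<bullet> y))"
    and decreasing: "\<And>i j. \<lbrakk>i \<le> j; j < n\<rbrakk> \<Longrightarrow> ev j \<le> ev i"
begin

lemma v_mult: "\<lbrakk>i < n; x \<in> carrier_vec n\<rbrakk> \<Longrightarrow> v i \<bullet> (A *\<^sub>v x) = ev i * (v i \<bullet> x)"
  using symmetric_scalar_prod[OF A sym, of "v i" x] v eigen by auto

lemma quadratic_form:
  assumes x: "x \<in> carrier_vec n"
  shows "x \<bullet> (A *\<^sub>v x) = (\<Sum>i<n. ev i * (v i \<bullet> x)\<^sup>2)"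
  using parseval[of x "A *\<^sub>v x"] x A
  by (simp add: v_mult power2_eq_square mult_ac)

lemma quadratic_form_le:
  assumes x: "x \<in> carrier_vec n" and n: "0 < n"
  shows "x \<bullet> (A *\<^sub>v x) \<le> ev 0 * (x \<bullet> x)"
  unfolding quadratic_form[OF x] parseval[OF x x] sum_distrib_left
  by (intro sum_mono) (auto simp: power2_eq_square decreasing intro!: mult_right_mono)

text \<open>One half of the Courant-Fischer principle: \<open>x\<close> lies in the span of the
  eigenvectors up to index \<open>k\<close>, whose eigenvalues are all at least
  \<open>ev k\<close>.\<close>

lemma quadratic_form_ge:
  assumes x: "x \<in> carrier_vec n" and k: "k < n"
    and orth: "\<And>i. \<lbrakk>k < i; i < n\<rbrakk> \<Longrightarrow> v i \<bullet> x = 0"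
  shows "ev k * (x \<bullet> x) \<le> x \<bullet> (A *\<^sub>v x)"
  unfolding quadratic_form[OF x] parseval[OF x x] sum_distrib_left
proof (intro sum_mono)
  fix i assume "i \<in> {..<n}"
  then show "ev k * ((v i \<bullet> x) * (v i \<bullet> x)) \<le> ev i * (v i \<bullet> x)\<^sup>2"
    using orth[of i] decreasing[of i k] k
    by (cases "k < i") (auto simp: power2_eq_square intro!: mult_right_mono)
qed

text \<open>Both sides are the trace of the square of \<open>A\<close>. By symmetry row
  \<open>i\<close> is the image of a basis vector; Parseval gives its squared length, and summing
  over \<open>i\<close> leaves the unit lengths of the \<open>v k\<close>.\<close>

lemma sum_squares:
  "(\<Sum>i<n. (ev i)\<^sup>2) = (\<Sum>i<n. \<Sum>j<n. (A $$ (i, j))\<^sup>2)"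
proof -
  have "(\<Sum>j<n. (A $$ (i, j))\<^sup>2) = (\<Sum>k<n. (ev k)\<^sup>2 * (v k $ i)\<^sup>2)" if i: "i < n" for i
  proof -
    have "A $$ (i, j) = A $$ (j, i)" if "j < n" for j
      using sym A i that by (metis carrier_matD index_transpose_mat(1))
    then have r: "row A i = A *\<^sub>v unit_vec n i" "row A i \<in> carrier_vec n"
      using A i by (auto intro!: eq_vecI)
    have "(\<Sum>j<n. (A $$ (i, j))\<^sup>2) = row A i \<bullet> row A i"
      using A i by (simp add: scalar_prod_def power2_eq_square lessThan_atLeast0)
    also have "\<dots> = (\<Sum>k<n. (ev k)\<^sup>2 * (v k $ i)\<^sup>2)"
      unfolding parseval[OF r(2) r(2)] unfolding r(1) using i v
      by (simp add: v_mult power2_eq_square mult_ac)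
    finally show ?thesis .
  qed
  then have "(\<Sum>i<n. \<Sum>j<n. (A $$ (i, j))\<^sup>2) = (\<Sum>i<n. \<Sum>k<n. (ev k)\<^sup>2 * (v k $ i)\<^sup>2)"
    by simp
  also have "\<dots> = (\<Sum>k<n. \<Sum>i<n. (ev k)\<^sup>2 * (v k $ i)\<^sup>2)"
    by (rule sum.swap)
  also have "\<dots> = (\<Sum>k<n. (ev k)\<^sup>2 * (v k \<bullet> v k))"
    using carrier_vecD[OF v]
    by (intro sum.cong)
      (auto simp: scalar_prod_def sum_distrib_left power2_eq_square lessThan_atLeast0)
  finally show ?thesis
    by (simp add: v_unit)
qed

end

lemma eigenbasis_exists:
  fixes A :: "real mat"
  assumes A: "A \<in> carrier_mat n n" and sym: "transpose_mat A = A"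
  shows "\<exists>v. eigenbasis n A ((!) (rev (sorted_list_of_multiset (proots (char_poly A))))) v"
proof -
  obtain as where as: "char_poly A = (\<Prod>a\<leftarrow>as. [:- a, 1:])" "length as = n"
    using real_symmetric_char_poly_splits[OF A sym] by blast
  define es where "es = rev (sorted_list_of_multiset (proots (char_poly A)))"
  have "(\<Prod>a\<leftarrow>xs. [:- a, 1:]) \<noteq> 0" for xs :: "real list"
    by (auto simp: prod_list_zero_iff)
  then have "proots (char_poly A) = mset as"
    unfolding as(1) by (induction as) (auto simp: proots_mult simp del: mult_pCons_left)
  then have es: "mset es = mset as" "length es = n"
    using as(2) by (auto simp: es_def)
  \<comment> \<open>Reordering the roots does not change the product, so the diagonalization can be
    taken with nonincreasing diagonal.\<close>
  have "(\<Prod>a\<leftarrow>es. [:- a, 1:]) = (\<Prod>a\<leftarrow>as. [:- a, 1:])"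
    using es(1) by (metis mset_map prod_mset_prod_list)
  then obtain P where P: "P \<in> carrier_mat n n" "transpose_mat P * P = 1\<^sub>m n"
    and D: "transpose_mat P * A * P = mat_diag n ((!) es)"
    using real_symmetric_diagonalization[OF A sym, of es] as(1) by auto
  \<comment> \<open>A left inverse of a square matrix is also a right inverse. This direction yields
    Parseval's identity for the columns of \<open>P\<close>.\<close>
  have PP: "P * transpose_mat P = 1\<^sub>m n"
    using mat_mult_left_right_inverse[OF _ P(1) P(2)] P(1) by simp
  have "eigenbasis n A ((!) es) (col P)"
  proof
    fix i assume i: "i < n"
    show "col P i \<in> carrier_vec n" using P i by auto
    show "col P i \<bullet> col P i = 1"
      using arg_cong[OF P(2), of "\<lambda>M. M $$ (i, i)"] P(1) i by simp
    have "A * P = (P * transpose_mat P) * A * P"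
      using A by (simp add: PP)
    also have "\<dots> = P * (transpose_mat P * A * P)"
      using P(1) A by (simp add: assoc_mult_mat[of _ n n _ n _ n])
    finally have "A * P = mat n n (\<lambda>(i, j). P $$ (i, j) * es ! j)"
      unfolding D using mat_diag_mult_right[OF P(1)] by simp
    then have "col (A * P) i = (es ! i) \<cdot>\<^sub>v col P i"
      using P(1) i by (auto intro!: eq_vecI)
    then show "A *\<^sub>v col P i = (es ! i) \<cdot>\<^sub>v col P i"
      using col_mult2[OF A P(1) i] by simp
  next
    fix x y :: "real vec" assume x: "x \<in> carrier_vec n" and y: "y \<in> carrier_vec n"
    have "x \<bullet> y = x \<bullet> (P *\<^sub>v (transpose_mat P *\<^sub>v y))"
      using P(1) y by (simp add: PP flip: assoc_mult_mat_vec[of _ n n _ n])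
    also have "\<dots> = (transpose_mat P *\<^sub>v x) \<bullet> (transpose_mat P *\<^sub>v y)"
      using P(1) x y by (subst transpose_vec_mult_scalar[of P n n]) auto
    also have "\<dots> = (\<Sum>i<n. (col P i \<bullet> x) * (col P i \<bullet> y))"
      using P(1) by (simp add: scalar_prod_def[of "transpose_mat P *\<^sub>v x"] lessThan_atLeast0)
    finally show "x \<bullet> y = (\<Sum>i<n. (col P i \<bullet> x) * (col P i \<bullet> y))" .
  next
    fix i j assume "i \<le> j" "j < n"
    then show "es ! j \<le> es ! i"
      using es(2) by (auto simp: es_def rev_nth intro!: sorted_nth_mono)
  qed (use A sym in auto)
  then show ?thesis by (auto simp: es_def)
qed

section \<open>Weyl's inequality for complementary matrices\<close>

text \<open>Only \<open>n - 1\<close> linear conditions are imposed on \<open>n\<close> unknowns; a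
  zero row in slot \<open>k\<close> makes the system square and its determinant 0.\<close>

lemma homogeneous_system_nontrivial:
  fixes f :: "nat \<Rightarrow> 'a :: field vec"
  assumes "k < n" and f: "\<And>i. i < n \<Longrightarrow> f i \<in> carrier_vec n"
  obtains x where "x \<in> carrier_vec n" "x \<noteq> 0\<^sub>v n" "\<And>i. \<lbrakk>i < n; i \<noteq> k\<rbrakk> \<Longrightarrow> f i \<bullet> x = 0"
proof -
  let ?M = "mat\<^sub>r n n (\<lambda>i. if i = k then 0\<^sub>v n else f i)"
  have "det ?M = 0"
    using assms by (intro det_row_0) auto
  then obtain x where x: "x \<in> carrier_vec n" "x \<noteq> 0\<^sub>v n" "?M *\<^sub>v x = 0\<^sub>v n"
    using det_0_iff_vec_prod_zero_field[of ?M n] by auto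
  have "f i \<bullet> x = 0" if "i < n" "i \<noteq> k" for i
  proof -
    have "f i \<bullet> x = (?M *\<^sub>v x) $ i"
      using that f by simp
    then show ?thesis using x(3) that by simp
  qed
  then show ?thesis using that x by blast
qed

text \<open>Weyl's inequality for \<open>A + B = J - I\<close>: on the hyperplane orthogonal to the all-ones vector
  the form of \<open>A + B\<close> is \<open>- (x \<bullet> x)\<close>, and this hyperplane meets the span of the top \<open>k + 1\<close>
  eigenvectors of \<open>A\<close> and the top \<open>n - k + 1\<close> eigenvectors of \<open>B\<close>.\<close>

lemma
  assumes A: "eigenbasis n A a v" and B: "eigenbasis n B b w"
    and AB: "\<And>i j. \<lbrakk>i < n; j < n\<rbrakk> \<Longrightarrow> A $$ (i, j) + B $$ (i, j) = (if i = j then 0 else 1)"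
  shows complementary_eigenvalue_sum_le: "\<lbrakk>1 \<le> k; k < n\<rbrakk> \<Longrightarrow> a k + b (n - k) \<le> -1"
    and complementary_top_eigenvalue_sum_ge: "0 < n \<Longrightarrow> real n - 1 \<le> a 0 + b 0"
proof -
  interpret A: eigenbasis n A a v by fact
  interpret B: eigenbasis n B b w by fact
  let ?one = "vec n (\<lambda>_. 1) :: real vec"
  \<comment> \<open>This is the quadratic form of \<open>J - I\<close>.\<close>
  have form: "x \<bullet> (A *\<^sub>v x) + x \<bullet> (B *\<^sub>v x) = (?one \<bullet> x)\<^sup>2 - x \<bullet> x" if x: "x \<in> carrier_vec n" for x
  proof -
    have "x \<bullet> (A *\<^sub>v x) + x \<bullet> (B *\<^sub>v x) = (\<Sum>i<n. \<Sum>j<n. x $ i * x $ j * (A $$ (i, j) + B $$ (i, j)))"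
      using x A.A B.A
      by (simp add: scalar_prod_def lessThan_atLeast0 sum_distrib_left sum.distrib algebra_simps)
    also have "\<dots> = (\<Sum>i<n. \<Sum>j<n. x $ i * x $ j - (if i = j then x $ i * x $ j else 0))"
      by (intro sum.cong) (auto simp: AB)
    also have "\<dots> = (?one \<bullet> x)\<^sup>2 - x \<bullet> x"
      using x by (simp add: scalar_prod_def lessThan_atLeast0 sum_subtractf power2_eq_square sum_product)
    finally show ?thesis .
  qed
  show "a k + b (n - k) \<le> -1" if k: "1 \<le> k" "k < n"
  proof -
    \<comment> \<open>The slots 1 to \<open>n - 1\<close> hold the all-ones vector, the
      \<open>k - 1\<close> vectors \<open>w i\<close> with \<open>i > n - k\<close>, and the
      \<open>n - 1 - k\<close> vectors \<open>v i\<close> with \<open>i > k\<close>. Slot 0 is the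
      one left free; \<open>w (n - k + j)\<close> sits in slot \<open>j + 1\<close>.\<close>
    define f where "f i = (if k < i then v i else if i = 1 then ?one else w (n - k + i - 1))" for i
    have "f i \<in> carrier_vec n" if "i < n" for i
      using that k by (auto simp: f_def intro!: A.v B.v)
    then obtain x where x: "x \<in> carrier_vec n" "x \<noteq> 0\<^sub>v n"
      and fx: "\<And>i. \<lbrakk>i < n; i \<noteq> 0\<rbrakk> \<Longrightarrow> f i \<bullet> x = 0"
      using homogeneous_system_nontrivial[of 0 n f] k by auto
    have "v i \<bullet> x = 0" if "k < i" "i < n" for i
      using fx[of i] that by (simp add: f_def)
    then have "a k * (x \<bullet> x) \<le> x \<bullet> (A *\<^sub>v x)"
      using k x by (intro A.quadratic_form_ge) auto
    moreover have "w i \<bullet> x = 0" if "n - k < i" "i < n" for i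
    proof -
      from \<open>n - k < i\<close> obtain j where "i = n - k + j" "0 < j"
        using less_imp_add_positive by blast
      moreover from this have "j < k"
        using that k by simp
      ultimately show ?thesis
        using fx[of "j + 1"] k by (simp add: f_def)
    qed
    then have "b (n - k) * (x \<bullet> x) \<le> x \<bullet> (B *\<^sub>v x)"
      using k x by (intro B.quadratic_form_ge) auto
    moreover have "?one \<bullet> x = 0"
      using fx[of 1] k by (simp add: f_def)
    ultimately have "(a k + b (n - k)) * (x \<bullet> x) \<le> (-1) * (x \<bullet> x)"
      using form[OF x(1)] by (simp add: algebra_simps)
    moreover have "0 < x \<bullet> x"
      using conjugate_square_greater_0_vec[OF x(1)] x(2) by simp
    ultimately show ?thesis
      by (metis mult_le_cancel_right_pos)
  qed
  \<comment> \<open>Both forms are evaluated at the all-ones vector, where their sum is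
    \<open>n * (n - 1)\<close>.\<close>
  show "real n - 1 \<le> a 0 + b 0" if n: "0 < n"
  proof -
    have oo: "?one \<bullet> ?one = real n"
      by (simp add: scalar_prod_def)
    have "(real n)\<^sup>2 - real n \<le> a 0 * real n + b 0 * real n"
      using form[of ?one] A.quadratic_form_le[of ?one] B.quadratic_form_le[of ?one] n
      by (simp add: oo)
    then have "real n * (real n - 1) \<le> real n * (a 0 + b 0)"
      by (simp add: power2_eq_square algebra_simps)
    then show ?thesis using n by simp
  qed
qed

section \<open>The inequality for eigenvalue sequences\<close>

lemma sum_largest_squares_less:
  fixes a b :: "nat \<Rightarrow> real"
  assumes s: "2 \<le> s" "3 * s - 2 \<le> n"
    and a: "\<And>i j. \<lbrakk>i \<le> j; j < n\<rbrakk> \<Longrightarrow> a j \<le> a i"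
    and b: "\<And>i j. \<lbrakk>i \<le> j; j < n\<rbrakk> \<Longrightarrow> b j \<le> b i"
    and weyl: "\<And>k. \<lbrakk>1 \<le> k; k < n\<rbrakk> \<Longrightarrow> a k + b (n - k) \<le> -1"
    and top: "real n - 1 \<le> a 0 + b 0"
    and total: "(\<Sum>k<n. (a k)\<^sup>2 + (b k)\<^sup>2) = real n * (real n - 1)"
  shows "(\<Sum>k=1..<s. (a k)\<^sup>2 + (b k)\<^sup>2) < (real n)\<^sup>2 / 4"
proof -
  define c where "c k = (a k)\<^sup>2 + (b k)\<^sup>2" for k
  \<comment> \<open>Stated for arbitrary \<open>f\<close> and \<open>g\<close> because it is applied
    with \<open>a\<close> and \<open>b\<close> in both roles.\<close>
  have sq: "(f k)\<^sup>2 \<le> (f (k + (s - 1)))\<^sup>2 + (g (n - k))\<^sup>2"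
    if f: "\<And>i j. \<lbrakk>i \<le> j; j < n\<rbrakk> \<Longrightarrow> f j \<le> f i"
      and fg: "f k + g (n - k) \<le> -1" and k: "k \<in> {1..<s}"
    for f g :: "nat \<Rightarrow> real" and k
  proof (cases "0 \<le> f k")
    case True
    then have "(f k)\<^sup>2 \<le> (g (n - k))\<^sup>2"
      using fg by (intro abs_le_square_iff[THEN iffD1]) auto
    then show ?thesis by (simp add: add_increasing)
  next
    case False
    moreover have "f (k + (s - 1)) \<le> f k"
      using k s by (intro f) auto
    ultimately have "(f k)\<^sup>2 \<le> (f (k + (s - 1)))\<^sup>2"
      by (intro abs_le_square_iff[THEN iffD1]) auto
    then show ?thesis by (simp add: add_increasing2)
  qed
  have "c k \<le> c (k + (s - 1)) + c (n - k)" if k: "k \<in> {1..<s}" for k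
  proof -
    \<comment> \<open>The inequality with the roles exchanged is Weyl's at index
      \<open>n - k\<close>.\<close>
    have kn: "1 \<le> k" "k < n" "1 \<le> n - k" "n - k < n" "n - (n - k) = k"
      using k s by auto
    then have "b k + a (n - k) \<le> -1" "a k + b (n - k) \<le> -1"
      using weyl[of "n - k"] weyl[of k] by (simp_all only: add.commute)
    then show ?thesis
      using sq[of a k b, OF a _ k] sq[of b k a, OF b _ k] by (simp add: c_def)
  qed
  then have "(\<Sum>k=1..<s. c k) \<le> (\<Sum>k=1..<s. c (k + (s - 1))) + (\<Sum>k=1..<s. c (n - k))"
    unfolding sum.distrib[symmetric] by (rule sum_mono)
  also have "(\<Sum>k=1..<s. c (k + (s - 1))) = (\<Sum>k\<in>{s..<2 * s - 1}. c k)"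
    using s by (intro sum.reindex_bij_witness[of _ "\<lambda>k. k - (s - 1)" "\<lambda>k. k + (s - 1)"]) auto
  also have "(\<Sum>k=1..<s. c (n - k)) = (\<Sum>k\<in>{n - s + 1..<n}. c k)"
    using s by (intro sum.reindex_bij_witness[of _ "\<lambda>k. n - k" "\<lambda>k. n - k"]) auto
  finally have "c 0 + 2 * (\<Sum>k=1..<s. c k)
      \<le> c 0 + (\<Sum>k=1..<s. c k) + (\<Sum>k\<in>{s..<2 * s - 1}. c k) + (\<Sum>k\<in>{n - s + 1..<n}. c k)"
    by simp
  also have "\<dots> = (\<Sum>k\<in>{0} \<union> {1..<s} \<union> {s..<2 * s - 1} \<union> {n - s + 1..<n}. c k)"
  proof -
    \<comment> \<open>The last two ranges are disjoint exactly when
      \<open>2 * s - 2 < n - s + 1\<close>, which is the bound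
      \<open>3 * s - 2 \<le> n\<close>.\<close>
    have "{0} \<inter> {1..<s} = {}" "({0} \<union> {1..<s}) \<inter> {s..<2 * s - 1} = {}"
      "({0} \<union> {1..<s} \<union> {s..<2 * s - 1}) \<inter> {n - s + 1..<n} = {}"
      using s by auto
    then show ?thesis
      by (simp only: sum.union_disjoint finite_atLeastLessThan finite_UnI finite.intros) simp
  qed
  also have "\<dots> \<le> (\<Sum>k<n. c k)"
    using s by (intro sum_mono2) (auto simp: c_def)
  also have "\<dots> = real n * (real n - 1)"
    using total by (simp add: c_def)
  finally have *: "c 0 + 2 * (\<Sum>k=1..<s. c k) \<le> real n * (real n - 1)" .
  have "(real n - 1)\<^sup>2 \<le> (a 0 + b 0)\<^sup>2"
    using top s by (intro power_mono) auto
  also have "\<dots> \<le> 2 * c 0"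
    using zero_le_power2[of "a 0 - b 0"] by (simp add: c_def power2_eq_square algebra_simps)
  \<comment> \<open>The sum is at most \<open>(n\<^sup>2 - 1) / 4\<close>, hence the strict
    inequality.\<close>
  finally have "(\<Sum>k=1..<s. c k) < (real n)\<^sup>2 / 4"
    using * by (simp add: power2_eq_square algebra_simps)
  then show ?thesis
    by (simp add: c_def)
qed

section \<open>Adjacency matrices of a graph and its complement\<close>

text \<open>The choice depends on the vertex set alone. With a common order of the vertices the two
  adjacency matrices can be added entry by entry.\<close>

lemma vertex_list_complement [simp]: "vertex_list (graph_complement G) = vertex_list G"
  by (simp add: vertex_list_def graph_complement_def)

lemma length_vertex_list: "pair_graph G \<Longrightarrow> length (vertex_list G) = card (pverts G)"
  by (metis distinct_card vertex_list)

lemma adjacency_matrix_eigenbasis: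
  assumes "pair_graph G" "card (pverts G) = n"
  shows "\<exists>v. eigenbasis n (adjacency_matrix G) ((!) (eigenvalue_list G)) v"
proof -
  interpret pair_graph G by fact
  have "(x, y) \<in> parcs G \<longleftrightarrow> (y, x) \<in> parcs G" for x y
    using pair_sym_arcs by (auto simp: symmetric_def dest: symD)
  then show ?thesis
    unfolding eigenvalue_list_def using assms
    by (intro eigenbasis_exists)
      (auto simp: adjacency_matrix_def Let_def length_vertex_list intro!: eq_matI)
qed

lemma adjacency_matrix_complement:
  assumes "pair_graph G" "i < card (pverts G)" "j < card (pverts G)"
  shows "adjacency_matrix (graph_complement G) $$ (i, j) =
    (if i = j then 0 else 1) - adjacency_matrix G $$ (i, j)"
proof -
  interpret pair_graph G by fact
  let ?vs = "vertex_list G"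
  have len: "i < length ?vs" "j < length ?vs"
    using assms(2,3) length_vertex_list[OF assms(1)] by simp_all
  have mem: "?vs ! i \<in> pverts G" "?vs ! j \<in> pverts G"
    using len vertex_list(2)[OF assms(1)] nth_mem by blast+
  have eq: "?vs ! i = ?vs ! j \<longleftrightarrow> i = j"
    using len vertex_list(1)[OF assms(1)] by (intro nth_eq_iff_index_eq)
  have loop: "(?vs ! j, ?vs ! j) \<notin> parcs G"
    using pair_no_loops[of "(?vs ! j, ?vs ! j)"] by auto
  have "(?vs ! i, ?vs ! j) \<in> parcs (graph_complement G) \<longleftrightarrow> i \<noteq> j \<and> (?vs ! i, ?vs ! j) \<notin> parcs G"
    using mem eq by (simp add: graph_complement_def)
  then show ?thesis
    using len loop by (auto simp: adjacency_matrix_def Let_def)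
qed

lemma adjacency_matrix_entry:
  assumes "pair_graph G" "i < card (pverts G)" "j < card (pverts G)"
  shows "adjacency_matrix G $$ (i, j) \<in> {0, 1}"
  using assms by (simp add: adjacency_matrix_def Let_def length_vertex_list)

theorem theorem1:
  fixes s n :: nat and G :: "'a pair_pre_digraph"
  assumes "s \<ge> 2" and "n \<ge> 3 * s - 2"
    and "pair_graph G" and "card (pverts G) = n"
  shows "(\<Sum>i = 2..s. (\<mu> i G)\<^sup>2 + (\<mu> i (graph_complement G))\<^sup>2) < (real n)\<^sup>2 / 4"
proof -
  let ?H = "graph_complement G"
  let ?A = "adjacency_matrix G" and ?B = "adjacency_matrix ?H"
  let ?a = "(!) (eigenvalue_list G)" and ?b = "(!) (eigenvalue_list ?H)"
  have cardH: "card (pverts ?H) = n"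
    using assms(4) by (simp add: graph_complement_def)
  obtain v where "eigenbasis n ?A ?a v"
    using adjacency_matrix_eigenbasis[OF assms(3,4)] by blast
  then interpret A: eigenbasis n ?A ?a v .
  obtain w where "eigenbasis n ?B ?b w"
    using adjacency_matrix_eigenbasis[OF pair_graph_complement[OF assms(3)] cardH] by blast
  then interpret B: eigenbasis n ?B ?b w .
  have AB: "?A $$ (i, j) + ?B $$ (i, j) = (if i = j then 0 else 1)" if "i < n" "j < n" for i j
    using adjacency_matrix_complement[OF assms(3)] that assms(4) by simp
  have entries: "?A $$ (i, j) \<in> {0, 1}" "?B $$ (i, j) \<in> {0, 1}" if "i < n" "j < n" for i j
    using that assms(4) cardH adjacency_matrix_entry[OF assms(3)]
      adjacency_matrix_entry[OF pair_graph_complement[OF assms(3)]] by simp_all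
  have "(\<Sum>k<n. (?a k)\<^sup>2 + (?b k)\<^sup>2) = (\<Sum>i<n. \<Sum>j<n. (?A $$ (i, j))\<^sup>2 + (?B $$ (i, j))\<^sup>2)"
    by (simp add: sum.distrib A.sum_squares B.sum_squares)
  \<comment> \<open>Off the diagonal exactly one of the two entries is 1; on it both vanish.\<close>
  also have "\<dots> = (\<Sum>i<n. \<Sum>j<n. 1 - (if i = j then 1 else 0))"
  proof (intro sum.cong refl)
    fix i j assume "i \<in> {..<n}" "j \<in> {..<n}"
    then show "(?A $$ (i, j))\<^sup>2 + (?B $$ (i, j))\<^sup>2 = 1 - (if i = j then 1 else 0)"
      using AB[of i j] entries[of i j] by auto
  qed
  also have "\<dots> = real n * (real n - 1)"
    by (simp add: sum_subtractf algebra_simps)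
  finally have total: "(\<Sum>k<n. (?a k)\<^sup>2 + (?b k)\<^sup>2) = real n * (real n - 1)" .
  \<comment> \<open>Shift from eigenvalues counted from 1 to list positions counted from 0.\<close>
  have "(\<Sum>i = 2..s. (\<mu> i G)\<^sup>2 + (\<mu> i ?H)\<^sup>2) = (\<Sum>k=1..<s. (?a k)\<^sup>2 + (?b k)\<^sup>2)"
    by (rule sum.reindex_bij_witness[of _ Suc "\<lambda>i. i - 1"]) (auto simp: graph_eigenvalue_def)
  also have "\<dots> < (real n)\<^sup>2 / 4"
    using assms(1,2) A.decreasing B.decreasing total
      complementary_eigenvalue_sum_le[OF A.eigenbasis_axioms B.eigenbasis_axioms AB]
      complementary_top_eigenvalue_sum_ge[OF A.eigenbasis_axioms B.eigenbasis_axioms AB]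
    by (intro sum_largest_squares_less) auto
  finally show ?thesis .
qed

end
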